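(* Let $V$ be the $\mathcal O_q$-module, with associated notation, described in the context. The following holds on $V$: $$H=\sum_{i=0}^{d}\frac{a^iq^{id}(A-\theta_0I)(A-\theta_1I)\cdots(A-\theta_{i-1}I)}{(q^2;q^2)_i},$$ $$H^{-1}=\sum_{i=0}^{d}\frac{a^{-i}q^{-id}(A-\theta_0I)(A-\theta_1I)\cdots(A-\theta_{i-1}I)}{(q^{-2};q^{-2})_i}.$$
   Context: Setting. $\mathbb F$ is a field and $q\in\mathbb F$ is nonzero and not a root of unity. Algebras are associative, unital, over $\mathbb F$. Write $[X,Y]=XY-YX$, $[X,Y]_q=qXY-q^{-1}YX$, $[X,Y]_{q^{-1}}=q^{-1}XY-qYX$. The $q$-Onsager algebra $\mathcal O_q$ is defined by generators $A,A^*$ and relations $[A,[A,[A,A^*]_q]_{q^{-1}}]=(q^2-q^{-2})^2[A^*,A]$ and $[A^*,[A^*,[A^*,A]_q]_{q^{-1}}]=(q^2-q^{-2})^2[A,A^*]$. $V$ is an irreducible $\mathcal O_q$-module of finite dimension at least $2$ on which each of $A,A^*$ is diagonalizable. Eigenspaces. The eigenvalues of $A$ on $V$ can be ordered as mutually distinct $\theta_0,\dots,\theta_d$ ($d\ge 1$) such that $\theta_i=aq^{d-2i}+a^{-1}q^{2i-d}$ ($0\le i\le d$) for some nonzero $a\in\mathbb F$; fix such an ordering and $a$. $V_i$ is the $\theta_i$-eigenspace of $A$ and $E_i\in\mathrm{End}(V)$ is the projection onto $V_i$ along $\bigoplus_{j\ne i}V_j$. The map $H$. Let $t_{ij}=1+\frac{\theta_i-\theta_j}{q-q^{-1}}\cdot\frac{q\theta_i-q^{-1}\theta_j}{q^2-q^{-2}}$,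 $t_i=t_{01}t_{12}\cdots t_{i-1,i}$ ($t_0=1$), and $H=\sum_{i=0}^d t_iE_i\in\mathrm{End}(V)$; each $t_i\neq0$, so $H$ is invertible with $H^{-1}=\sum_{i=0}^d t_i^{-1}E_i$. Notation. $(z;t)_n=(1-z)(1-zt)\cdots(1-zt^{n-1})$ for $n\in\mathbb N=\{0,1,2,\dots\}$; empty products equal $1$ (or $I$). *)

theory Defs
  imports Complex_Main "HOL-Algebra.QuotRing" "HOL-Library.Poly_Mapping"
begin

datatype oq_gen = Gen_A | Gen_Astar

datatype oq_word = Word (letters: "oq_gen list")

text \<open>Words in the two generators, written additively (\<^term>\<open>(+)\<close> is concatenation), so that
  \<^typ>\<open>oq_word \<Rightarrow>\<^sub>0 'f\<close> with its library multiplication (convolution) is the monoid algebra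
  of the free monoid, that is, the free associative unital algebra on two generators.\<close>

instantiation oq_word :: monoid_add
begin

definition zero_oq_word :: oq_word where
  "0 = Word []"

definition plus_oq_word :: "oq_word \<Rightarrow> oq_word \<Rightarrow> oq_word" where
  "u + v = Word (letters u @ letters v)"

instance
  by standard (simp_all add: zero_oq_word_def plus_oq_word_def)

end

type_synonym 'f oq_free = "oq_word \<Rightarrow>\<^sub>0 'f"

definition fgen :: "oq_gen \<Rightarrow> 'f::field oq_free" where
  "fgen g = Poly_Mapping.single (Word [g]) 1"

definition fscalar :: "'f::field \<Rightarrow> 'f oq_free" where
  "fscalar c = Poly_Mapping.single 0 c"

definition comm :: "'f::field oq_free \<Rightarrow> 'f oq_free \<Rightarrow> 'f oq_free" where
  "comm X Y = X * Y - Y * X"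

definition qcomm :: "'f::field \<Rightarrow> 'f oq_free \<Rightarrow> 'f oq_free \<Rightarrow> 'f oq_free" where
  "qcomm q X Y = fscalar q * (X * Y) - fscalar (inverse q) * (Y * X)"

text \<open>Left-hand side minus right-hand side of the defining relation
  $[X,[X,[X,Y]_q]_{q^{-1}}] = (q^2-q^{-2})^2 [Y,X]$; note that
  $[X,Y]_{q^{-1}}$ is \<^term>\<open>qcomm (inverse q) X Y\<close>.\<close>

definition oq_relator :: "'f::field \<Rightarrow> 'f oq_free \<Rightarrow> 'f oq_free \<Rightarrow> 'f oq_free" where
  "oq_relator q X Y =
     comm X (qcomm (inverse q) X (qcomm q X Y))
     - fscalar ((q ^ 2 - inverse q ^ 2) ^ 2) * comm Y X"

definition free_ring :: "'f::field oq_free ring" where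
  "free_ring = \<lparr>carrier = UNIV, mult = (*), one = 1, zero = 0, add = (+)\<rparr>"

definition oq_ideal :: "'f::field \<Rightarrow> 'f oq_free set" where
  "oq_ideal q = Idl\<^bsub>free_ring\<^esub>
     {oq_relator q (fgen Gen_A) (fgen Gen_Astar), oq_relator q (fgen Gen_Astar) (fgen Gen_A)}"

definition q_Onsager :: "'f::field \<Rightarrow> 'f oq_free set ring" where
  "q_Onsager q = free_ring Quot (oq_ideal q)"

definition oq_class :: "'f::field \<Rightarrow> 'f oq_free \<Rightarrow> 'f oq_free set" where
  "oq_class q x = oq_ideal q +>\<^bsub>free_ring\<^esub> x"

definition oq_A :: "'f::field \<Rightarrow> 'f oq_free set" where
  "oq_A q = oq_class q (fgen Gen_A)"

definition oq_Astar :: "'f::field \<Rightarrow> 'f oq_free set" where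
  "oq_Astar q = oq_class q (fgen Gen_Astar)"

definition oq_scalar :: "'f::field \<Rightarrow> 'f \<Rightarrow> 'f oq_free set" where
  "oq_scalar q c = oq_class q (fscalar c)"

definition End_ring :: "('f::field \<Rightarrow> 'v::ab_group_add \<Rightarrow> 'v) \<Rightarrow> ('v \<Rightarrow> 'v) ring" where
  "End_ring scale =
     \<lparr>carrier = {f. Vector_Spaces.linear scale scale f}, mult = (\<circ>), one = id,
      zero = (\<lambda>v. 0), add = (\<lambda>f g v. f v + g v)\<rparr>"

text \<open>The vector space is the whole type \<^typ>\<open>'v\<close>; the module structure is an algebra
  homomorphism from the q-Onsager algebra to its endomorphism algebra.\<close>

definition oq_module ::
  "('f::field \<Rightarrow> 'v::ab_group_add \<Rightarrow> 'v) \<Rightarrow> 'f \<Rightarrow> ('f oq_free set \<Rightarrow> 'v \<Rightarrow> 'v) \<Rightarrow> bool" where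
  "oq_module scale q act \<longleftrightarrow>
     vector_space scale \<and>
     act \<in> ring_hom (q_Onsager q) (End_ring scale) \<and>
     (\<forall>c. act (oq_scalar q c) = scale c)"

definition oq_submodule ::
  "('f::field \<Rightarrow> 'v::ab_group_add \<Rightarrow> 'v) \<Rightarrow> 'f \<Rightarrow> ('f oq_free set \<Rightarrow> 'v \<Rightarrow> 'v) \<Rightarrow> 'v set \<Rightarrow> bool" where
  "oq_submodule scale q act W \<longleftrightarrow>
     module.subspace scale W \<and> (\<forall>x\<in>carrier (q_Onsager q). \<forall>w\<in>W. act x w \<in> W)"

definition irreducible_oq_module ::
  "('f::field \<Rightarrow> 'v::ab_group_add \<Rightarrow> 'v) \<Rightarrow> 'f \<Rightarrow> ('f oq_free set \<Rightarrow> 'v \<Rightarrow> 'v) \<Rightarrow> bool" where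
  "irreducible_oq_module scale q act \<longleftrightarrow>
     oq_module scale q act \<and> (UNIV :: 'v set) \<noteq> {0} \<and>
     (\<forall>W. oq_submodule scale q act W \<longrightarrow> W = {0} \<or> W = UNIV)"

definition eigenspace ::
  "('f::field \<Rightarrow> 'v::ab_group_add \<Rightarrow> 'v) \<Rightarrow> ('v \<Rightarrow> 'v) \<Rightarrow> 'f \<Rightarrow> 'v set" where
  "eigenspace scale T c = {v. T v = scale c v}"

definition eigenvalues ::
  "('f::field \<Rightarrow> 'v::ab_group_add \<Rightarrow> 'v) \<Rightarrow> ('v \<Rightarrow> 'v) \<Rightarrow> 'f set" where
  "eigenvalues scale T = {c. \<exists>v. v \<noteq> 0 \<and> T v = scale c v}"

definition diagonalizable ::
  "('f::field \<Rightarrow> 'v::ab_group_add \<Rightarrow> 'v) \<Rightarrow> ('v \<Rightarrow> 'v) \<Rightarrow> bool" where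
  "diagonalizable scale T \<longleftrightarrow>
     (\<exists>B. \<not> module.dependent scale B \<and> module.span scale B = UNIV \<and>
          (\<forall>b\<in>B. \<exists>c. T b = scale c b))"

text \<open>Meaningful when the space is the direct sum of the subspaces \<^term>\<open>W\<close> and \<^term>\<open>U\<close>.\<close>

definition projection_along :: "'v::ab_group_add set \<Rightarrow> 'v set \<Rightarrow> 'v \<Rightarrow> 'v" where
  "projection_along W U v = (THE w. w \<in> W \<and> v - w \<in> U)"

text \<open>The sum of the subspaces $V_j$ ($j \le d$, $j \ne i$) is the span of their union.\<close>

definition eigenprojection ::
  "('f::field \<Rightarrow> 'v::ab_group_add \<Rightarrow> 'v) \<Rightarrow> ('v \<Rightarrow> 'v) \<Rightarrow> (nat \<Rightarrow> 'f) \<Rightarrow> nat \<Rightarrow> nat \<Rightarrow> 'v \<Rightarrow> 'v" where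
  "eigenprojection scale T \<theta> d i =
     projection_along (eigenspace scale T (\<theta> i))
       (module.span scale (\<Union>j\<in>{0..d} - {i}. eigenspace scale T (\<theta> j)))"

definition tt :: "'f::field \<Rightarrow> (nat \<Rightarrow> 'f) \<Rightarrow> nat \<Rightarrow> nat \<Rightarrow> 'f" where
  "tt q \<theta> i j =
     1 + (\<theta> i - \<theta> j) / (q - inverse q) * ((q * \<theta> i - inverse q * \<theta> j) / (q ^ 2 - inverse q ^ 2))"

definition tcoeff :: "'f::field \<Rightarrow> (nat \<Rightarrow> 'f) \<Rightarrow> nat \<Rightarrow> 'f" where
  "tcoeff q \<theta> i = (\<Prod>k=1..i. tt q \<theta> (k - 1) k)"

definition H_map ::
  "('f::field \<Rightarrow> 'v::ab_group_add \<Rightarrow> 'v) \<Rightarrow> 'f \<Rightarrow> ('v \<Rightarrow> 'v) \<Rightarrow> (nat \<Rightarrow> 'f) \<Rightarrow> nat \<Rightarrow> 'v \<Rightarrow> 'v" where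
  "H_map scale q T \<theta> d =
     (\<lambda>v. \<Sum>i=0..d. scale (tcoeff q \<theta> i) (eigenprojection scale T \<theta> d i v))"

definition qpoch :: "'f::field \<Rightarrow> 'f \<Rightarrow> nat \<Rightarrow> 'f" where
  "qpoch z t n = (\<Prod>k<n. 1 - z * t ^ k)"

text \<open>$(T-\theta_0 I)(T-\theta_1 I)\cdots(T-\theta_{i-1}I)$\<close>

primrec shifted_prod ::
  "('f::field \<Rightarrow> 'v::ab_group_add \<Rightarrow> 'v) \<Rightarrow> ('v \<Rightarrow> 'v) \<Rightarrow> (nat \<Rightarrow> 'f) \<Rightarrow> nat \<Rightarrow> 'v \<Rightarrow> 'v" where
  "shifted_prod scale T \<theta> 0 = id"
| "shifted_prod scale T \<theta> (Suc i) =
     shifted_prod scale T \<theta> i \<circ> (\<lambda>v. T v - scale (\<theta> i) v)"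

lemma ring_free_ring: "ring (free_ring :: 'f::field oq_free ring)"
proof (rule ringI)
  show "abelian_group (free_ring :: 'f oq_free ring)"
  proof (rule abelian_groupI)
    fix x :: "'f oq_free"
    show "\<exists>y\<in>carrier free_ring. y \<oplus>\<^bsub>free_ring\<^esub> x = \<zero>\<^bsub>free_ring\<^esub>"
      by (rule bexI[of _ "- x"]) (simp_all add: free_ring_def)
  qed (simp_all add: free_ring_def algebra_simps)
  show "Group.monoid (free_ring :: 'f oq_free ring)"
    by (rule monoidI) (simp_all add: free_ring_def algebra_simps)
qed (simp_all add: free_ring_def algebra_simps)

lemma ideal_oq_ideal: "ideal (oq_ideal q) free_ring"
  unfolding oq_ideal_def
  by (rule ring.genideal_ideal[OF ring_free_ring]) (simp add: free_ring_def)

lemma oq_class_hom: "oq_class q \<in> ring_hom free_ring (q_Onsager q)"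
  using ideal.rcos_ring_hom[OF ideal_oq_ideal, of q]
  unfolding q_Onsager_def oq_class_def[abs_def] by simp

lemma oq_class_relator:
  "oq_class q (oq_relator q (fgen Gen_A) (fgen Gen_Astar)) = \<zero>\<^bsub>q_Onsager q\<^esub>"
  "oq_class q (oq_relator q (fgen Gen_Astar) (fgen Gen_A)) = \<zero>\<^bsub>q_Onsager q\<^esub>"
proof -
  interpret ideal "oq_ideal q" free_ring by (rule ideal_oq_ideal)
  have "{oq_relator q (fgen Gen_A) (fgen Gen_Astar), oq_relator q (fgen Gen_Astar) (fgen Gen_A)}
        \<subseteq> oq_ideal q"
    unfolding oq_ideal_def by (rule genideal_self) (simp add: free_ring_def)
  then show
    "oq_class q (oq_relator q (fgen Gen_A) (fgen Gen_Astar)) = \<zero>\<^bsub>q_Onsager q\<^esub>"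
    "oq_class q (oq_relator q (fgen Gen_Astar) (fgen Gen_A)) = \<zero>\<^bsub>q_Onsager q\<^esub>"
    by (simp_all add: oq_class_def q_Onsager_def FactRing_def a_rcos_const)
qed

text \<open>The two generators act by linear maps satisfying the defining relations.\<close>

lemma oq_module_relations:
  fixes scale :: "'f::field \<Rightarrow> 'v::ab_group_add \<Rightarrow> 'v"
  assumes M: "oq_module scale q act"
  defines "C \<equiv> (\<lambda>X Y v. X (Y v) - Y (X v))"
    and "Q \<equiv> (\<lambda>p X Y v. scale p (X (Y v)) - scale (inverse p) (Y (X v)))"
    and "A \<equiv> act (oq_A q)" and "B \<equiv> act (oq_Astar q)"
  shows "Vector_Spaces.linear scale scale A" "Vector_Spaces.linear scale scale B"
    and "C A (Q (inverse q) A (Q q A B)) = (\<lambda>v. scale ((q ^ 2 - inverse q ^ 2) ^ 2) (C B A v))"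
    and "C B (Q (inverse q) B (Q q B A)) = (\<lambda>v. scale ((q ^ 2 - inverse q ^ 2) ^ 2) (C A B v))"
proof -
  define ev where "ev x = act (oq_class q x)" for x
  have ah: "act \<in> ring_hom (q_Onsager q) (End_ring scale)"
    and sc: "act (oq_scalar q c) = scale c" for c
    using M by (simp_all add: oq_module_def)
  note oh = oq_class_hom[of q]
  have cl: "oq_class q x \<in> carrier (q_Onsager q)" for x
    using ring_hom_closed[OF oh] by (simp add: free_ring_def)
  have lin: "Vector_Spaces.linear scale scale (ev x)" for x
    using ring_hom_closed[OF ah cl] by (simp add: End_ring_def ev_def)
  have mult: "ev (x * y) = ev x \<circ> ev y" for x y
    using ring_hom_mult[OF oh, of x y] ring_hom_mult[OF ah cl cl, of x y]
    by (simp add: End_ring_def ev_def free_ring_def)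
  have add: "ev (x + y) = (\<lambda>v. ev x v + ev y v)" for x y
    using ring_hom_add[OF oh, of x y] ring_hom_add[OF ah cl cl, of x y]
    by (simp add: End_ring_def ev_def free_ring_def)
  have sub: "ev (x - y) = (\<lambda>v. ev x v - ev y v)" for x y
    using add[of "x - y" y] by (simp add: fun_eq_iff)
  have fs: "ev (fscalar c) = scale c" for c
    using sc by (simp add: ev_def oq_scalar_def)
  have z: "ev 0 = (\<lambda>v. 0)"
    using sub[of 0 0] by simp
  have zc: "oq_class q 0 = \<zero>\<^bsub>q_Onsager q\<^esub>"
    using ring_hom_zero[OF oh ring_free_ring]
      ideal.quotient_is_ring[OF ideal_oq_ideal, of q]
    by (simp add: free_ring_def q_Onsager_def)
  have A: "A = ev (fgen Gen_A)" and B: "B = ev (fgen Gen_Astar)"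
    by (simp_all add: A_def B_def ev_def oq_A_def oq_Astar_def)
  show "Vector_Spaces.linear scale scale A" "Vector_Spaces.linear scale scale B"
    using lin by (simp_all add: A B)
  have ec: "ev (comm x y) = C (ev x) (ev y)" for x y
    by (simp add: comm_def sub mult C_def fun_eq_iff)
  have eq: "ev (qcomm p x y) = Q p (ev x) (ev y)" for p x y
    by (simp add: qcomm_def sub mult fs Q_def fun_eq_iff)
  have rel: "ev (oq_relator q x y) =
      (\<lambda>v. C (ev x) (Q (inverse q) (ev x) (Q q (ev x) (ev y))) v
         - scale ((q ^ 2 - inverse q ^ 2) ^ 2) (C (ev y) (ev x) v))" for x y
    by (simp add: oq_relator_def sub mult fs ec eq fun_eq_iff)
  have "ev (oq_relator q (fgen Gen_A) (fgen Gen_Astar)) = (\<lambda>v. 0)"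
    "ev (oq_relator q (fgen Gen_Astar) (fgen Gen_A)) = (\<lambda>v. 0)"
    using z by (simp_all add: ev_def oq_class_relator zc)
  then show
    "C A (Q (inverse q) A (Q q A B)) = (\<lambda>v. scale ((q ^ 2 - inverse q ^ 2) ^ 2) (C B A v))"
    "C B (Q (inverse q) B (Q q B A)) = (\<lambda>v. scale ((q ^ 2 - inverse q ^ 2) ^ 2) (C A B v))"
    unfolding rel A B by (simp_all add: fun_eq_iff)
qed

end

theory Submission
  imports Defs
begin

text \<open>
  Since \<open>A\<close> is diagonalizable, it is enough to compare scalars on each eigenspace \<open>V\<^sub>n\<close>. Write
  \<open>Q = q\<^sup>2\<close> and \<open>c = a\<^sup>2 Q\<^bsup>d-n\<^esup>\<close>. The factor \<open>t\<^bsub>k-1,k\<^esub>\<close> equals \<open>a\<^sup>2 Q\<^bsup>d-2k+1\<^esup>\<close>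
  (\<open>tt_consecutive\<close>), so \<open>H\<close> acts on \<open>V\<^sub>n\<close> as \<open>t\<^sub>n = c\<^sup>n\<close> (\<open>tcoeff_closed_form\<close>).

  On the other side, \<open>a q\<^sup>d (\<theta>\<^sub>n - \<theta>\<^sub>k) = (1 - Q\<^bsup>n-k\<^esup>) (c - Q\<^sup>k)\<close>, so the \<open>i\<close>-th summand acts on
  \<open>V\<^sub>n\<close> as the Gaussian binomial coefficient of \<open>n\<close> over \<open>i\<close> in base \<open>Q\<close> times
  \<open>(c - 1) (c - Q) \<dots> (c - Q\<^bsup>i-1\<^esup>)\<close>. By the q-binomial expansion of a power
  (\<open>power_eq_sum_gauss_binomial\<close>, a form of the q-Chu-Vandermonde sum), these add up
  to \<open>c\<^sup>n\<close> too.

  The eigenvalues \<open>\<theta>\<^sub>i\<close> do not change when \<open>a\<close> and \<open>q\<close> are both replaced by their inverses, while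
  \<open>c\<close> becomes its inverse. The same computation therefore shows that the second sum acts on
  \<open>V\<^sub>n\<close> as \<open>t\<^sub>n\<^sup>-\<^sup>1\<close>.
\<close>

section \<open>A finite q-binomial identity\<close>

text \<open>For \<^term>\<open>x = Q ^ n\<close> this is the Gaussian binomial coefficient of \<^term>\<open>n\<close> over \<^term>\<open>i\<close>.
  Keeping \<^term>\<open>x\<close> as a parameter avoids exponents \<^term>\<open>n - k\<close>, and lets the
  Pascal rule below hold without a case distinction.\<close>

definition gauss_binomial :: "'f::field \<Rightarrow> 'f \<Rightarrow> nat \<Rightarrow> 'f" where
  "gauss_binomial Q x i = (\<Prod>k<i. 1 - x / Q ^ k) / qpoch Q Q i"

lemma gauss_binomial_0 [simp]: "gauss_binomial Q x 0 = 1"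
  by (simp add: gauss_binomial_def qpoch_def)

lemma gauss_binomial_eq_0:
  assumes "Q \<noteq> 0" "n < i"
  shows "gauss_binomial Q (Q ^ n) i = 0"
  using assms by (auto simp: gauss_binomial_def)

lemma qpoch_nonzero:
  assumes "\<And>n::nat. n > 0 \<Longrightarrow> Q ^ n \<noteq> 1"
  shows "qpoch Q Q i \<noteq> 0"
  using assms[of "Suc _"] by (auto simp: qpoch_def)

text \<open>Both sides are multiples of \<^term>\<open>gauss_binomial Q x i\<close>: passing from \<^term>\<open>x\<close> to
  \<^term>\<open>Q * x\<close> shifts the product in the numerator by one factor.\<close>

lemma gauss_binomial_pascal:
  assumes "Q \<noteq> 0" and ru: "\<And>n::nat. n > 0 \<Longrightarrow> Q ^ n \<noteq> 1"
  shows "gauss_binomial Q (Q * x) (Suc i) =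
    gauss_binomial Q x i + Q ^ Suc i * gauss_binomial Q x (Suc i)"
proof -
  have nz: "1 - Q ^ Suc i \<noteq> 0" using ru[of "Suc i"] by simp
  have up: "gauss_binomial Q (Q * x) (Suc i) =
      gauss_binomial Q x i * ((1 - Q * x) / (1 - Q ^ Suc i))"
    using assms(1) unfolding gauss_binomial_def prod.lessThan_Suc_shift
    by (simp add: qpoch_def)
  have right: "gauss_binomial Q x (Suc i) =
      gauss_binomial Q x i * ((1 - x / Q ^ i) / (1 - Q ^ Suc i))"
    by (simp add: gauss_binomial_def qpoch_def)
  have "(1 - Q * x) / (1 - Q ^ Suc i) = 1 + Q ^ Suc i * ((1 - x / Q ^ i) / (1 - Q ^ Suc i))"
    using nz assms(1) by (simp add: divide_simps) (simp add: algebra_simps)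
  then show ?thesis
    unfolding up right by (simp add: algebra_simps)
qed

text \<open>Powers of \<^term>\<open>c\<close> expanded in the Newton basis with nodes \<^term>\<open>Q ^ k\<close>. In the
  induction step one writes \<^term>\<open>c = (c - Q ^ i) + Q ^ i\<close> in front of the \<^term>\<open>i\<close>-th basis
  element and collects terms with the Pascal rule.\<close>

lemma power_eq_sum_gauss_binomial:
  fixes Q c :: "'f::field"
  assumes Q: "Q \<noteq> 0" and ru: "\<And>n::nat. n > 0 \<Longrightarrow> Q ^ n \<noteq> 1"
  shows "(\<Sum>i\<le>n. gauss_binomial Q (Q ^ n) i * (\<Prod>k<i. c - Q ^ k)) = c ^ n"
proof (induction n)
  case 0
  then show ?case by simp
next
  case (Suc n)
  define g where "g = gauss_binomial Q (Q ^ n)"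
  define P where "P i = (\<Prod>k<i. c - Q ^ k)" for i
  have top: "g (Suc n) = 0" using gauss_binomial_eq_0[OF Q] by (simp add: g_def)
  have pascal: "gauss_binomial Q (Q ^ Suc n) (Suc i) = g i + Q ^ Suc i * g (Suc i)" for i
    using gauss_binomial_pascal[OF Q ru, of "Q ^ n" i] by (simp add: g_def)
  have P: "P (Suc i) + Q ^ i * P i = c * P i" for i
    by (simp add: P_def algebra_simps)
  have "(\<Sum>i\<le>Suc n. gauss_binomial Q (Q ^ Suc n) i * P i)
      = 1 + (\<Sum>i\<le>n. (g i + Q ^ Suc i * g (Suc i)) * P (Suc i))"
    unfolding sum.atMost_Suc_shift pascal by (simp add: P_def)
  also have "\<dots> = (\<Sum>i\<le>n. g i * P (Suc i)) + (\<Sum>i\<le>Suc n. Q ^ i * g i * P i)"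
    unfolding sum.atMost_Suc_shift[of _ n]
    by (simp add: P_def[of 0] g_def distrib_right sum.distrib)
  also have "\<dots> = (\<Sum>i\<le>n. g i * (P (Suc i) + Q ^ i * P i))"
    using top by (simp add: distrib_left sum.distrib mult_ac)
  also have "\<dots> = c * (\<Sum>i\<le>n. g i * P i)"
    unfolding P by (simp add: sum_distrib_left mult_ac)
  also have "\<dots> = c ^ Suc n"
    using Suc.IH by (simp add: g_def P_def)
  finally show ?case by (simp add: P_def)
qed

section \<open>The eigenvalues of the two operators\<close>

lemma power_int_diff_nat:
  fixes q :: "'f::field"
  assumes "q \<noteq> 0"
  shows "q powi (int m - int n) = q ^ m / q ^ n"
  using assms by (simp add: power_int_diff)

text \<open>With \<^term>\<open>Q = q ^ 2\<close> and \<^term>\<open>c = a ^ 2 * q ^ (2 * d) / Q ^ n\<close>, the scalar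
  \<^term>\<open>a * q ^ d * (\<theta> n - \<theta> k)\<close> factors as \<^term>\<open>(1 - Q ^ n / Q ^ k) * (c - Q ^ k)\<close>. The first
  factors make up the Gaussian binomial coefficient, the second ones the Newton basis.\<close>

lemma newton_sum_at_eigenvalue:
  fixes q a :: "'f::field" and \<theta> :: "nat \<Rightarrow> 'f"
  assumes q: "q \<noteq> 0" and ru: "\<And>n::nat. n > 0 \<Longrightarrow> q ^ n \<noteq> 1" and a: "a \<noteq> 0"
    and theta: "\<And>i. i \<le> d \<Longrightarrow>
      \<theta> i = a * q powi (int d - 2 * int i) + inverse a * q powi (2 * int i - int d)"
    and n: "n \<le> d"
  shows "(\<Sum>i=0..d. a ^ i * q ^ (i * d) / qpoch (q ^ 2) (q ^ 2) i * (\<Prod>k<i. \<theta> n - \<theta> k))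
    = (a ^ 2 * q ^ (2 * d) / q ^ (2 * n)) ^ n"
proof -
  define Q where "Q = q ^ 2"
  define c where "c = a ^ 2 * q ^ (2 * d) / q ^ (2 * n)"
  have Q: "Q \<noteq> 0" using q by (simp add: Q_def)
  have ruQ: "Q ^ m \<noteq> 1" if "m > 0" for m :: nat
    using ru[of "2 * m"] that by (simp add: Q_def power_mult)
  have scaled: "a * q ^ d * \<theta> i = a ^ 2 * q ^ (2 * d) / Q ^ i + Q ^ i" if "i \<le> d" for i
  proof -
    have "q ^ d * q powi (int d - 2 * int i) = q powi (int (2 * d) - int (2 * i))"
      using q by (simp add: power_int_add[symmetric] flip: power_int_of_nat)
    also have "\<dots> = q ^ (2 * d) / q ^ (2 * i)"
      using q by (rule power_int_diff_nat)
    finally have 1: "q ^ d * q powi (int d - 2 * int i) = q ^ (2 * d) / Q ^ i"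
      by (simp add: Q_def power_mult)
    have "q ^ d * q powi (2 * int i - int d) = q powi int (2 * i)"
      using q by (simp add: power_int_add[symmetric] flip: power_int_of_nat)
    then have 2: "q ^ d * q powi (2 * int i - int d) = Q ^ i"
      by (simp only: power_int_of_nat Q_def power_mult)
    have "a * q ^ d * \<theta> i = a ^ 2 * (q ^ d * q powi (int d - 2 * int i))
        + q ^ d * q powi (2 * int i - int d)"
      using a by (simp add: theta[OF that] algebra_simps power2_eq_square)
    then show ?thesis unfolding 1 2 by simp
  qed
  have factor: "a * q ^ d * (\<theta> n - \<theta> k) = (1 - Q ^ n / Q ^ k) * (c - Q ^ k)" if "k \<le> d" for k
  proof -
    have "a ^ 2 * q ^ (2 * d) = c * Q ^ n"
      using q by (simp add: c_def Q_def power_mult)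
    then have "a * q ^ d * (\<theta> n - \<theta> k) = (c * Q ^ n / Q ^ n + Q ^ n) - (c * Q ^ n / Q ^ k + Q ^ k)"
      using scaled[OF n] scaled[OF that] by (simp add: right_diff_distrib)
    then show ?thesis using Q by (simp add: divide_simps) (simp add: algebra_simps)
  qed
  have "a ^ i * q ^ (i * d) / qpoch Q Q i * (\<Prod>k<i. \<theta> n - \<theta> k)
      = gauss_binomial Q (Q ^ n) i * (\<Prod>k<i. c - Q ^ k)" if "i \<le> d" for i
  proof -
    have "a ^ i * q ^ (i * d) * (\<Prod>k<i. \<theta> n - \<theta> k) = (\<Prod>k<i. a * q ^ d * (\<theta> n - \<theta> k))"
      by (simp add: prod.distrib power_mult_distrib power_mult[symmetric] mult.commute[of d])
    also have "\<dots> = (\<Prod>k<i. (1 - Q ^ n / Q ^ k) * (c - Q ^ k))"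
      using that by (intro prod.cong refl factor) auto
    finally show ?thesis
      by (simp add: gauss_binomial_def prod.distrib)
  qed
  then have "(\<Sum>i=0..d. a ^ i * q ^ (i * d) / qpoch Q Q i * (\<Prod>k<i. \<theta> n - \<theta> k))
      = (\<Sum>i=0..d. gauss_binomial Q (Q ^ n) i * (\<Prod>k<i. c - Q ^ k))"
    by (intro sum.cong) auto
  also have "\<dots> = (\<Sum>i\<le>n. gauss_binomial Q (Q ^ n) i * (\<Prod>k<i. c - Q ^ k))"
    using n gauss_binomial_eq_0[OF Q] by (intro sum.mono_neutral_right) auto
  also have "\<dots> = c ^ n"
    by (rule power_eq_sum_gauss_binomial[OF Q ruQ])
  finally show ?thesis by (simp add: Q_def c_def)
qed

text \<open>Put \<open>x = a q\<^bsup>d-2k-1\<^esup>\<close>, the geometric mean of the leading terms of \<^term>\<open>\<theta> k\<close> and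
  \<^term>\<open>\<theta> (Suc k)\<close>. Then the two quotients in \<^const>\<open>tt\<close> are \<open>x - 1 / x\<close> and \<open>x\<close>, so that
  the whole expression collapses to \<open>x\<^sup>2\<close>.\<close>

lemma tt_consecutive:
  fixes q a :: "'f::field" and \<theta> :: "nat \<Rightarrow> 'f"
  assumes q: "q \<noteq> 0" and ru: "\<And>n::nat. n > 0 \<Longrightarrow> q ^ n \<noteq> 1" and a: "a \<noteq> 0"
    and theta: "\<And>i. i \<le> d \<Longrightarrow>
      \<theta> i = a * q powi (int d - 2 * int i) + inverse a * q powi (2 * int i - int d)"
    and k: "Suc k \<le> d"
  shows "tt q \<theta> k (Suc k) = a ^ 2 * q ^ (2 * d) / q ^ (4 * k + 2)"
proof -
  define x where "x = a * q powi (int d - 2 * int k - 1)"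
  have x: "x \<noteq> 0" using a q by (simp add: x_def)
  have inv_x: "inverse x = inverse a * q powi (1 + 2 * int k - int d)"
    by (simp add: x_def power_int_minus[symmetric] algebra_simps)
  have th0: "\<theta> k = x * q + inverse x * inverse q"
  proof -
    have "int d - 2 * int k = (int d - 2 * int k - 1) + 1" by simp
    then have 1: "q powi (int d - 2 * int k) = q powi (int d - 2 * int k - 1) * q"
      using q by (metis power_int_add power_int_1_right)
    have "2 * int k - int d = (1 + 2 * int k - int d) + (- 1)" by simp
    then have 2: "q powi (2 * int k - int d) = q powi (1 + 2 * int k - int d) * inverse q"
      using q by (metis power_int_add power_int_minus power_int_1_right)
    show ?thesis using k by (simp add: theta 1 2 inv_x) (simp add: x_def)
  qed
  have th1: "\<theta> (Suc k) = x * inverse q + inverse x * q"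
  proof -
    have "int d - 2 * int (Suc k) = (int d - 2 * int k - 1) + (- 1)" by simp
    then have 1: "q powi (int d - 2 * int (Suc k)) = q powi (int d - 2 * int k - 1) * inverse q"
      using q by (metis power_int_add power_int_minus power_int_1_right)
    have "2 * int (Suc k) - int d = (1 + 2 * int k - int d) + 1" by simp
    then have 2: "q powi (2 * int (Suc k) - int d) = q powi (1 + 2 * int k - int d) * q"
      using q by (metis power_int_add power_int_1_right)
    show ?thesis unfolding theta[OF k] 1 2 inv_x by (simp add: x_def)
  qed
  have nz1: "q - inverse q \<noteq> 0"
    using ru[of 2] q by (auto simp: power2_eq_square field_simps)
  have nz2: "q ^ 2 - inverse q ^ 2 \<noteq> 0"
  proof
    assume "q ^ 2 - inverse q ^ 2 = 0"
    then have "q ^ 2 * q ^ 2 = 1" using q by (simp add: field_simps)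
    then show False using ru[of 4] by (simp add: power_add[symmetric])
  qed
  have "\<theta> k - \<theta> (Suc k) = (q - inverse q) * (x - inverse x)"
    unfolding th0 th1 by (simp add: algebra_simps)
  moreover have "q * \<theta> k - inverse q * \<theta> (Suc k) = (q ^ 2 - inverse q ^ 2) * x"
    unfolding th0 th1 using q by (simp add: algebra_simps power2_eq_square)
  ultimately have "tt q \<theta> k (Suc k) = 1 + (x - inverse x) * x"
    using nz1 nz2 by (simp add: tt_def)
  also have "\<dots> = x ^ 2"
    using x by (simp add: algebra_simps power2_eq_square)
  also have "\<dots> = a ^ 2 * q powi (int (2 * d) - int (4 * k + 2))"
    using q by (simp add: x_def power_mult_distrib power2_eq_square power_int_add[symmetric] algebra_simps)
  also have "\<dots> = a ^ 2 * q ^ (2 * d) / q ^ (4 * k + 2)"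
    by (simp only: power_int_diff_nat[OF q] times_divide_eq_right)
  finally show ?thesis .
qed

lemma tcoeff_closed_form:
  fixes q a :: "'f::field" and \<theta> :: "nat \<Rightarrow> 'f"
  assumes q: "q \<noteq> 0" and ru: "\<And>n::nat. n > 0 \<Longrightarrow> q ^ n \<noteq> 1" and a: "a \<noteq> 0"
    and theta: "\<And>i. i \<le> d \<Longrightarrow>
      \<theta> i = a * q powi (int d - 2 * int i) + inverse a * q powi (2 * int i - int d)"
    and n: "n \<le> d"
  shows "tcoeff q \<theta> n = (a ^ 2 * q ^ (2 * d) / q ^ (2 * n)) ^ n"
  using n
proof (induction n)
  case 0
  then show ?case by (simp add: tcoeff_def)
next
  case (Suc n)
  define b where "b = a ^ 2 * q ^ (2 * d)"
  have "tcoeff q \<theta> (Suc n) = tcoeff q \<theta> n * tt q \<theta> n (Suc n)"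
    by (simp add: tcoeff_def)
  also have "\<dots> = (b / q ^ (2 * n)) ^ n * (b / q ^ (4 * n + 2))"
    using Suc tt_consecutive[OF q ru a theta] by (simp add: b_def)
  also have "\<dots> = b ^ Suc n / q ^ (2 * n * n + (4 * n + 2))"
    by (simp add: power_divide power_mult[symmetric] power_add mult_ac)
  also have "2 * n * n + (4 * n + 2) = 2 * Suc n * Suc n"
    by simp
  also have "b ^ Suc n / q ^ (2 * Suc n * Suc n) = (b / q ^ (2 * Suc n)) ^ Suc n"
    by (simp only: power_divide power_mult)
  finally show ?case by (simp add: b_def)
qed

section \<open>Functions of a diagonalizable operator\<close>

locale diagonalized_operator = vector_space scale
  for scale :: "'f::field \<Rightarrow> 'v::ab_group_add \<Rightarrow> 'v" (infixr \<open>*s\<close> 75) +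
  fixes T :: "'v \<Rightarrow> 'v" and \<theta> :: "nat \<Rightarrow> 'f" and d :: nat
  assumes linear_T: "Vector_Spaces.linear scale scale T"
    and diag_T: "diagonalizable scale T"
    and distinct: "inj_on \<theta> {0..d}"
    and eigenvalues_T: "eigenvalues scale T \<subseteq> \<theta> ` {0..d}"
begin

lemma T_add: "T (v + w) = T v + T w" and T_scale: "T (c *s v) = c *s T v"
  using linear_T by (simp_all add: Vector_Spaces.linear_iff)

lemma subspace_eigenspace: "subspace (eigenspace scale T c)"
proof -
  have "T 0 = 0" using T_scale[of 0 0] by simp
  then show ?thesis
    by (auto simp: eigenspace_def subspace_def T_add T_scale scale_right_distrib mult.commute)
qed

text \<open>The eigenbasis lies in the set of sums of eigenvectors, which is a subspace.\<close>

lemma eigenvector_decomposition: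
  obtains w where "\<And>i. i \<le> d \<Longrightarrow> w i \<in> eigenspace scale T (\<theta> i)" "v = (\<Sum>i=0..d. w i)"
proof -
  define S where "S = {v. \<exists>w. (\<forall>i\<le>d. w i \<in> eigenspace scale T (\<theta> i)) \<and> v = (\<Sum>i=0..d. w i)}"
  obtain B where B: "span B = UNIV" "\<And>b. b \<in> B \<Longrightarrow> \<exists>c. T b = c *s b"
    using diag_T unfolding diagonalizable_def by blast
  note es = subspace_eigenspace
  have "subspace S"
  proof (rule subspaceI)
    show "0 \<in> S"
      unfolding S_def by (auto intro!: exI[of _ "\<lambda>_. 0"] subspace_0[OF es])
  next
    fix x y assume "x \<in> S" "y \<in> S"
    then obtain u w where uw: "\<forall>i\<le>d. u i \<in> eigenspace scale T (\<theta> i)" "x = (\<Sum>i=0..d. u i)"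
      "\<forall>i\<le>d. w i \<in> eigenspace scale T (\<theta> i)" "y = (\<Sum>i=0..d. w i)"
      unfolding S_def by blast
    then show "x + y \<in> S"
      unfolding S_def
      by (auto intro!: exI[of _ "\<lambda>i. u i + w i"] subspace_add[OF es] simp: sum.distrib)
  next
    fix c x assume "x \<in> S"
    then obtain u where "\<forall>i\<le>d. u i \<in> eigenspace scale T (\<theta> i)" "x = (\<Sum>i=0..d. u i)"
      unfolding S_def by blast
    then show "c *s x \<in> S"
      unfolding S_def
      by (auto intro!: exI[of _ "\<lambda>i. c *s u i"] subspace_scale[OF es] simp: scale_sum_right)
  qed
  moreover have "B \<subseteq> S"
  proof
    fix b assume "b \<in> B"
    then obtain c where c: "T b = c *s b" using B by blast
    show "b \<in> S"
    proof (cases "b = 0")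
      case True
      then show ?thesis using subspace_0[OF \<open>subspace S\<close>] by simp
    next
      case False
      then have "c \<in> \<theta> ` {0..d}" using c eigenvalues_T by (auto simp: eigenvalues_def)
      then obtain j where j: "j \<le> d" "c = \<theta> j" by auto
      have "\<forall>i\<le>d. (if i = j then b else 0) \<in> eigenspace scale T (\<theta> i)"
        using c j subspace_0[OF es] by (auto simp: eigenspace_def)
      moreover have "b = (\<Sum>i=0..d. if i = j then b else 0)"
        using j by simp
      ultimately show ?thesis
        unfolding S_def mem_Collect_eq by (intro exI[of _ "\<lambda>i. if i = j then b else 0"] conjI)
    qed
  qed
  ultimately have "v \<in> S"
    using span_minimal[of B S] B(1) by auto
  then show thesis using that unfolding S_def by blast
qed

text \<open>The map is the product of the factors \<^term>\<open>\<lambda>v. T v - \<theta> j *s v\<close> over \<^term>\<open>j \<in> J\<close>. For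
  \<^term>\<open>J = {0..d} - {i}\<close> it shows that the \<^term>\<open>i\<close>-th eigenspace meets the sum of the others
  only in zero, which makes the description in \<^const>\<open>projection_along\<close> unique.\<close>

lemma annihilator_exists:
  assumes "finite J" "J \<subseteq> {0..d}" "i \<le> d" "i \<notin> J"
  shows "\<exists>P c. Vector_Spaces.linear scale scale P \<and> c \<noteq> 0 \<and>
    (\<forall>w\<in>eigenspace scale T (\<theta> i). P w = c *s w) \<and>
    (\<forall>j\<in>J. \<forall>w\<in>eigenspace scale T (\<theta> j). P w = 0)"
  using assms
proof (induction J)
  case empty
  have "Vector_Spaces.linear scale scale (\<lambda>v. v)" by (rule linear_ident)
  then show ?case by (intro exI[of _ "\<lambda>v. v"] exI[of _ 1]) simp
next
  case (insert m J)
  then obtain P c where P: "Vector_Spaces.linear scale scale P" "c \<noteq> 0"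
    "\<And>w. w \<in> eigenspace scale T (\<theta> i) \<Longrightarrow> P w = c *s w"
    "\<And>j w. j \<in> J \<Longrightarrow> w \<in> eigenspace scale T (\<theta> j) \<Longrightarrow> P w = 0"
    by auto
  have Ps: "P (x *s v) = x *s P v" and Pa: "P (v + w) = P v + P w" for x v w
    using P(1) by (simp_all add: Vector_Spaces.linear_iff)
  define R where "R v = P (T v - \<theta> m *s v)" for v
  have "R (v + w) = R v + R w" for v w
    unfolding R_def Pa[symmetric] by (simp add: T_add scale_right_distrib add_diff_add)
  moreover have "R (x *s v) = x *s R v" for x v
    unfolding R_def Ps[symmetric] by (simp add: T_scale scale_right_diff_distrib mult.commute)
  ultimately have "Vector_Spaces.linear scale scale R"
    using vector_space_axioms by (simp add: Vector_Spaces.linear_iff)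
  moreover have "\<theta> i - \<theta> m \<noteq> 0"
    using distinct insert.prems by (auto simp: inj_on_def)
  moreover have R: "R w = (x - \<theta> m) *s P w" if "w \<in> eigenspace scale T x" for w x
    using that by (simp add: R_def eigenspace_def scale_left_diff_distrib[symmetric] Ps)
  ultimately show ?case
    using P by (intro exI[of _ R] exI[of _ "(\<theta> i - \<theta> m) * c"]) (auto simp: R)
qed

lemma eigenprojection_sum:
  assumes w: "\<And>i. i \<le> d \<Longrightarrow> w i \<in> eigenspace scale T (\<theta> i)" and i: "i \<le> d"
  shows "eigenprojection scale T \<theta> d i (\<Sum>j=0..d. w j) = w i"
proof -
  define U where "U = span (\<Union>j\<in>{0..d} - {i}. eigenspace scale T (\<theta> j))"
  have inter: "x = 0" if "x \<in> eigenspace scale T (\<theta> i)" "x \<in> U" for x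
  proof -
    have "finite ({0..d} - {i})" "{0..d} - {i} \<subseteq> {0..d}" "i \<notin> {0..d} - {i}"
      by auto
    from annihilator_exists[OF this(1,2) i this(3)]
    obtain P c where P: "Vector_Spaces.linear scale scale P" "c \<noteq> 0"
      "\<And>w. w \<in> eigenspace scale T (\<theta> i) \<Longrightarrow> P w = c *s w"
      "\<And>j w. j \<in> {0..d} - {i} \<Longrightarrow> w \<in> eigenspace scale T (\<theta> j) \<Longrightarrow> P w = 0"
      by blast
    interpret P: Vector_Spaces.linear scale scale P by (rule P(1))
    have "P x = 0"
      by (rule P.eq_0_on_span[OF _ that(2)[unfolded U_def]]) (use P(4) in blast)
    then have "c *s x = 0" using P(3)[OF that(1)] by simp
    then show "x = 0" using P(2) by simp
  qed
  have sub: "w j \<in> U" if "j \<in> {0..d} - {i}" for j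
    using w[of j] that unfolding U_def by (auto intro!: span_base)
  have "(\<Sum>j=0..d. w j) = w i + (\<Sum>j\<in>{0..d} - {i}. w j)"
    using i by (intro sum.remove) auto
  moreover have "(\<Sum>j\<in>{0..d} - {i}. w j) \<in> U"
    unfolding U_def by (rule span_sum) (rule sub[unfolded U_def])
  ultimately have rest: "(\<Sum>j=0..d. w j) - w i \<in> U"
    by simp
  have "projection_along (eigenspace scale T (\<theta> i)) U (\<Sum>j=0..d. w j) = w i"
    unfolding projection_along_def
  proof (rule the_equality)
    fix x assume x: "x \<in> eigenspace scale T (\<theta> i) \<and> (\<Sum>j=0..d. w j) - x \<in> U"
    have "((\<Sum>j=0..d. w j) - w i) - ((\<Sum>j=0..d. w j) - x) \<in> U"
      using rest x unfolding U_def by (metis span_diff)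
    moreover have "x - w i \<in> eigenspace scale T (\<theta> i)"
      by (rule subspace_diff[OF subspace_eigenspace conjunct1[OF x] w[OF i]])
    ultimately show "x = w i" using inter[of "x - w i"] by simp
  qed (rule conjI[OF w[OF i] rest])
  then show ?thesis by (simp add: eigenprojection_def U_def)
qed

text \<open>The operator that acts on each eigenspace as the given scalar.\<close>

definition spectral :: "(nat \<Rightarrow> 'f) \<Rightarrow> 'v \<Rightarrow> 'v" where
  "spectral t v = (\<Sum>i=0..d. t i *s eigenprojection scale T \<theta> d i v)"

lemma spectral_sum:
  assumes "\<And>i. i \<le> d \<Longrightarrow> w i \<in> eigenspace scale T (\<theta> i)"
  shows "spectral t (\<Sum>i=0..d. w i) = (\<Sum>i=0..d. t i *s w i)"
  unfolding spectral_def by (intro sum.cong refl) (simp add: eigenprojection_sum[OF assms])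

lemma spectral_inverse:
  assumes "\<And>i. i \<le> d \<Longrightarrow> s i * t i = 1"
  shows "spectral s (spectral t v) = v"
proof -
  obtain w where w: "\<And>i. i \<le> d \<Longrightarrow> w i \<in> eigenspace scale T (\<theta> i)" "v = (\<Sum>i=0..d. w i)"
    using eigenvector_decomposition[of v] by metis
  have "spectral s (\<Sum>i=0..d. t i *s w i) = (\<Sum>i=0..d. s i *s t i *s w i)"
    by (intro spectral_sum subspace_scale subspace_eigenspace w)
  also have "\<dots> = v"
    unfolding w(2) using assms by (intro sum.cong) auto
  finally show ?thesis using spectral_sum[OF w(1)] w(2) by simp
qed

lemma shifted_prod_eigenvector:
  assumes "v \<in> eigenspace scale T x"
  shows "shifted_prod scale T \<theta> i v = (\<Prod>k<i. x - \<theta> k) *s v"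
  using assms
proof (induction i arbitrary: v)
  case 0
  then show ?case by simp
next
  case (Suc i)
  have "T v - \<theta> i *s v = (x - \<theta> i) *s v"
    using Suc.prems by (simp add: eigenspace_def scale_left_diff_distrib)
  moreover have "(x - \<theta> i) *s v \<in> eigenspace scale T x"
    using Suc.prems by (rule subspace_scale[OF subspace_eigenspace])
  ultimately show ?case by (simp add: Suc.IH mult.commute)
qed

lemma shifted_prod_sum:
  "shifted_prod scale T \<theta> i (\<Sum>j\<in>J. w j) = (\<Sum>j\<in>J. shifted_prod scale T \<theta> i (w j))"
proof (induction i arbitrary: w)
  case 0
  then show ?case by simp
next
  case (Suc i)
  interpret T: Vector_Spaces.linear scale scale T by (rule linear_T)
  show ?case
    by (simp add: T.sum scale_sum_right sum_subtractf[symmetric] Suc.IH)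
qed

text \<open>An operator given by Newton interpolation is determined by its values at the nodes.\<close>

lemma newton_sum_eq_spectral:
  assumes "\<And>n. n \<le> d \<Longrightarrow> (\<Sum>i=0..d. c i * (\<Prod>k<i. \<theta> n - \<theta> k)) = t n"
  shows "(\<Sum>i=0..d. c i *s shifted_prod scale T \<theta> i v) = spectral t v"
proof -
  obtain w where w: "\<And>i. i \<le> d \<Longrightarrow> w i \<in> eigenspace scale T (\<theta> i)" "v = (\<Sum>i=0..d. w i)"
    using eigenvector_decomposition[of v] by metis
  have "(\<Sum>i=0..d. c i *s shifted_prod scale T \<theta> i v)
      = (\<Sum>i=0..d. \<Sum>n=0..d. (c i * (\<Prod>k<i. \<theta> n - \<theta> k)) *s w n)"
    unfolding w(2) shifted_prod_sum scale_sum_right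
  proof (intro sum.cong refl)
    fix i n assume "n \<in> {0..d}"
    then have "w n \<in> eigenspace scale T (\<theta> n)" using w(1) by simp
    then show "c i *s shifted_prod scale T \<theta> i (w n) = (c i * (\<Prod>k<i. \<theta> n - \<theta> k)) *s w n"
      by (simp add: shifted_prod_eigenvector)
  qed
  also have "\<dots> = (\<Sum>n=0..d. (\<Sum>i=0..d. c i * (\<Prod>k<i. \<theta> n - \<theta> k)) *s w n)"
    unfolding scale_sum_left by (rule sum.swap)
  also have "\<dots> = (\<Sum>n=0..d. t n *s w n)"
    by (intro sum.cong refl) (simp add: assms)
  also have "\<dots> = spectral t v"
    unfolding w(2) by (rule spectral_sum[OF w(1), symmetric])
  finally show ?thesis .
qed

end

section \<open>The expansions of H and its inverse\<close>

theorem proposition3p18: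
  fixes scale :: "'f::field \<Rightarrow> 'v::ab_group_add \<Rightarrow> 'v"
    and Basis :: "'v set"
    and q a :: 'f
    and act :: "'f oq_free set \<Rightarrow> 'v \<Rightarrow> 'v"
    and A Astar H :: "'v \<Rightarrow> 'v"
    and \<theta> :: "nat \<Rightarrow> 'f"
    and d :: nat
  assumes q_nonzero: "q \<noteq> 0"
    and q_not_root_of_unity: "\<And>n::nat. n > 0 \<Longrightarrow> q ^ n \<noteq> 1"
    and finite_dim: "finite_dimensional_vector_space scale Basis"
    and dim_ge_2: "vector_space.dim scale (UNIV :: 'v set) \<ge> 2"
    and irreducible: "irreducible_oq_module scale q act"
    and A_eq: "A = act (oq_A q)"
    and Astar_eq: "Astar = act (oq_Astar q)"
    and diag_A: "diagonalizable scale A"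
    and diag_Astar: "diagonalizable scale Astar"
    and d_ge_1: "d \<ge> 1"
    and a_nonzero: "a \<noteq> 0"
    and theta_distinct: "inj_on \<theta> {0..d}"
    and theta_eigenvalues: "\<theta> ` {0..d} = eigenvalues scale A"
    and theta_form: "\<And>i. i \<le> d \<Longrightarrow>
          \<theta> i = a * q powi (int d - 2 * int i) + inverse a * q powi (2 * int i - int d)"
    and H_eq: "H = H_map scale q A \<theta> d"
  shows "H = (\<lambda>v. \<Sum>i=0..d.
            scale (a ^ i * q ^ (i * d) / qpoch (q ^ 2) (q ^ 2) i) (shifted_prod scale A \<theta> i v)) \<and>
    bij H \<and>
    inv_into UNIV H = (\<lambda>v. \<Sum>i=0..d.
            scale (a powi (- int i) * q powi (- int (i * d)) / qpoch (q powi (-2)) (q powi (-2)) i)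
              (shifted_prod scale A \<theta> i v))"
proof -
  have M: "oq_module scale q act"
    using irreducible by (simp add: irreducible_oq_module_def)
  then interpret vector_space scale by (simp add: oq_module_def)
  have "Vector_Spaces.linear scale scale A"
    unfolding A_eq by (rule oq_module_relations(1)[OF M])
  then interpret diagonalized_operator scale A \<theta> d
    using diag_A theta_distinct theta_eigenvalues vector_space_axioms
    by (simp add: diagonalized_operator_def diagonalized_operator_axioms_def)
  note q = q_nonzero and ru = q_not_root_of_unity
  define t where "t = tcoeff q \<theta>"
  have t: "t n = (a ^ 2 * q ^ (2 * d) / q ^ (2 * n)) ^ n" if "n \<le> d" for n
    unfolding t_def by (rule tcoeff_closed_form[OF q ru a_nonzero theta_form that])
  have t_nz: "t n \<noteq> 0" if "n \<le> d" for n
    using t[OF that] q a_nonzero by simp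
  have H: "H = spectral t"
    by (simp add: H_eq H_map_def spectral_def[abs_def] t_def)
  have expansion: "H = (\<lambda>v. \<Sum>i=0..d.
      scale (a ^ i * q ^ (i * d) / qpoch (q ^ 2) (q ^ 2) i) (shifted_prod scale A \<theta> i v))"
    unfolding H fun_eq_iff
    using newton_sum_at_eigenvalue[OF q ru a_nonzero theta_form] t
    by (intro allI newton_sum_eq_spectral[symmetric]) simp_all
  define G where "G = spectral (\<lambda>n. inverse (t n))"
  have GH: "G (H v) = v" and HG: "H (G v) = v" for v
    unfolding G_def H by (rule spectral_inverse; simp add: t_nz)+
  have bij: "bij H"
    by (rule bij_betw_byWitness[where f' = G]) (auto simp: GH HG)
  have inv: "inv_into UNIV H = G"
    using GH HG by (intro inv_equality) auto
  \<comment> \<open>The hypotheses on \<open>a\<close>, \<open>q\<close> and \<open>\<theta>\<close> hold for the inverses of \<open>a\<close> and \<open>q\<close> as well.\<close>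
  have theta_form': "\<theta> i = inverse a * inverse q powi (int d - 2 * int i)
      + inverse (inverse a) * inverse q powi (2 * int i - int d)" if "i \<le> d" for i
  proof -
    have "inverse q powi (int d - 2 * int i) = q powi (2 * int i - int d)"
      "inverse q powi (2 * int i - int d) = q powi (int d - 2 * int i)"
      using power_int_minus[of q "int d - 2 * int i"] power_int_minus[of q "2 * int i - int d"]
      by (simp_all add: power_int_inverse)
    then show ?thesis using theta_form[OF that] by simp
  qed
  have ru': "inverse q ^ n \<noteq> 1" if "n > 0" for n :: nat
    using ru[OF that] by (simp add: power_inverse)
  have "G = (\<lambda>v. \<Sum>i=0..d.
      scale (inverse a ^ i * inverse q ^ (i * d) / qpoch (inverse q ^ 2) (inverse q ^ 2) i)
        (shifted_prod scale A \<theta> i v))"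
    unfolding G_def fun_eq_iff
  proof (intro allI newton_sum_eq_spectral[symmetric])
    fix n assume n: "n \<le> d"
    have "(inverse a ^ 2 * inverse q ^ (2 * d) / inverse q ^ (2 * n)) ^ n = inverse (t n)"
      by (simp add: t[OF n] power_inverse divide_inverse power_mult_distrib)
    then show "(\<Sum>i=0..d. inverse a ^ i * inverse q ^ (i * d)
        / qpoch (inverse q ^ 2) (inverse q ^ 2) i * (\<Prod>k<i. \<theta> n - \<theta> k)) = inverse (t n)"
      using newton_sum_at_eigenvalue[OF _ ru' _ theta_form' n] q a_nonzero by simp
  qed
  moreover have "q powi (- 2) = inverse q ^ 2"
    by (simp add: power_int_minus power_inverse)
  moreover have "x powi (- int m) = inverse x ^ m" for x :: 'f and m
    by (simp add: power_int_minus power_inverse)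
  ultimately have "inv_into UNIV H = (\<lambda>v. \<Sum>i=0..d.
      scale (a powi (- int i) * q powi (- int (i * d)) / qpoch (q powi (-2)) (q powi (-2)) i)
        (shifted_prod scale A \<theta> i v))"
    by (simp only: inv)
  with expansion bij show ?thesis by blast
qed

end
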